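(* Suppose $\mathscr{F}$ and $\mathscr{G}$ are constructible cosheaves over $\mathbb{R}$ with a common set of critical values $S$. Let $\mathcal{U}$ be a nice open cover of $\mathbb{R}$, with set of boundary points $B$. Assume that $$d_I(\mathscr{F},\mathscr{G})<\min\{|s-b|:s\in S,\ b\in B\}.$$ Then $$d_I(\mathcal{M}_\mathcal{U}(\mathscr{F}),\mathcal{M}_\mathcal{U}(\mathscr{G}))< d_I(\mathscr{F},\mathscr{G}).$$ Moreover, if $\mathscr{F}$ is the Reeb cosheaf of a constructible $\mathbb{R}$-space $(\mathbb{X},f)$ and $\mathscr{G}$ is the Reeb cosheaf of a constructible $\mathbb{R}$-space $(\mathbb{X},g)$ on the same space $\mathbb{X}$, then $$d_I(\mathcal{M}_\mathcal{U}(\mathscr{F}),\mathcal{M}_\mathcal{U}(\mathscr{G}))<\|f-g\|_\infty .$$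
   Context: Let $\mathbf{Int}$ be the category of (nonempty) connected open subsets of $\mathbb{R}$ ("open intervals") with inclusions. A pre-cosheaf on $\mathbb{R}$ is a functor $\mathscr{F}:\mathbf{Int}\to\mathbf{Set}$, with structure maps $\mathscr{F}[U\subset V]$. It is a cosheaf if $\varinjlim_{V\in\mathcal{V}}\mathscr{F}(V)=\mathscr{F}(U)$ (via the canonical map) for each open interval $U$ and each open interval cover $\mathcal{V}$ of $U$ closed under (nonempty) finite intersections. A cosheaf is constructible with set of critical values $S$ if $S\subset\mathbb{R}$ is finite and $\mathscr{F}[U\subset V]$ is an isomorphism for all open intervals $U\subset V$ with $S\cap U=S\cap V$. A nice cover of $\mathbb{R}$ is an open cover $\mathcal{U}$ by open intervals, all nonempty intersections of which are contractible, with $\mathcal{U}_x=\{V\in\mathcal{U}:x\in V\}$ finite for every $x\in\mathbb{R}$. Its set of boundary points $B$ is the set of all (finite) endpoints of members of $\mathcal{U}$. For an open interval $U$, $\mathcal{I}_\mathcal{U}(U)=\bigcup_{x\in U}\bigcap_{V\in\mathcal{U}_x}V$, again an open interval, and the mapper functor is $\mathcal{M}_\mathcal{U}(\mathscr{C})(U)=\mathscr{C}(\mathcal{I}_\mathcal{U}(U))$. For $U=(a,b)$ and $\varepsilon\ge0$ let $U_\varepsilon=(a-\varepsilon,b+\varepsilon)$. An $\varepsilon$-interleaving between $\mathscr{F},\mathscr{G}$ consists of families of maps $\varphi_U:\mathscr{F}(U)\to\mathscr{G}(U_\varepsilon)$, $\psi_U:\mathscr{G}(U)\to\mathscr{F}(U_\varepsilon)$,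 natural with respect to inclusions, with $\psi_{U_\varepsilon}\circ\varphi_U=\mathscr{F}[U\subset U_{2\varepsilon}]$ and $\varphi_{U_\varepsilon}\circ\psi_U=\mathscr{G}[U\subset U_{2\varepsilon}]$ for all open intervals $U$; $d_I(\mathscr{F},\mathscr{G})$ is the infimum of all $\varepsilon$ for which an $\varepsilon$-interleaving exists. A constructible $\mathbb{R}$-space is a pair $(\mathbb{X},f)$ with $f:\mathbb{X}\to\mathbb{R}$ continuous for which there are $a_0<\dots<a_n$ in $\mathbb{R}$, locally path-connected spaces $\mathbb{V}_0,\dots,\mathbb{V}_n$, $\mathbb{E}_0,\dots,\mathbb{E}_{n-1}$ and continuous maps $\ell_i:\mathbb{E}_i\to\mathbb{V}_i$, $r_i:\mathbb{E}_i\to\mathbb{V}_{i+1}$ such that $\mathbb{X}$ is the quotient of $\coprod_i\mathbb{V}_i\times\{a_i\}\sqcup\coprod_i\mathbb{E}_i\times[a_i,a_{i+1}]$ by $(\ell_i(x),a_i)\sim(x,a_i)$, $(r_i(x),a_{i+1})\sim(x,a_{i+1})$ for $x\in\mathbb{E}_i$, with $f$ the projection to the second factor. Its Reeb cosheaf is $\mathscr{R}_f(U)=\pi_0(f^{-1}(U))$ (set of path components).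
   Formalization: Each strict inequality is replaced by "strict, or both sides are 0": as printed the claims fail when d_I(F,G)=0 (e.g. F=G) or f=g, where they read 0<0; whenever the right-hand side is positive the statement is the printed one. *)

theory Defs
  imports "HOL-Analysis.Analysis"
begin

section \<open>Pre-cosheaves and cosheaves on the real line\<close>

definition open_interval :: "real set \<Rightarrow> bool" where
  "open_interval U \<longleftrightarrow> open U \<and> connected U \<and> U \<noteq> {}"

text \<open>Functors from the poset of open intervals to sets. Only the values of \<open>ob\<close> on open intervals,
  and of \<open>mor F U V\<close> on \<open>ob F U\<close> for open intervals \<open>U \<subseteq> V\<close>, are meaningful.\<close>

record 'a precosheaf_data =
  ob :: "real set \<Rightarrow> 'a set"
  mor :: "real set \<Rightarrow> real set \<Rightarrow> 'a \<Rightarrow> 'a"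

definition precosheaf :: "'a precosheaf_data \<Rightarrow> bool" where
  "precosheaf F \<longleftrightarrow>
     (\<forall>U V. open_interval U \<and> open_interval V \<and> U \<subseteq> V \<longrightarrow> mor F U V \<in> ob F U \<rightarrow> ob F V) \<and>
     (\<forall>U. open_interval U \<longrightarrow> (\<forall>x\<in>ob F U. mor F U U x = x)) \<and>
     (\<forall>U V W. open_interval U \<and> open_interval V \<and> open_interval W \<and> U \<subseteq> V \<and> V \<subseteq> W \<longrightarrow>
        (\<forall>x\<in>ob F U. mor F V W (mor F U V x) = mor F U W x))"

text \<open>The colimit in sets of \<open>F\<close> over a family \<open>\<V>\<close> of intervals, ordered by inclusion: the disjoint
  union of the sets \<open>ob F V\<close>, modulo the equivalence relation generated by the structure maps.\<close>

definition colim_step ::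
  "'a precosheaf_data \<Rightarrow> real set set \<Rightarrow> real set \<times> 'a \<Rightarrow> real set \<times> 'a \<Rightarrow> bool" where
  "colim_step F \<V> p q \<longleftrightarrow>
     (\<exists>V\<in>\<V>. \<exists>W\<in>\<V>. V \<subseteq> W \<and> (\<exists>x\<in>ob F V. p = (V, x) \<and> q = (W, mor F V W x)))"

definition colim :: "'a precosheaf_data \<Rightarrow> real set set \<Rightarrow> (real set \<times> 'a) set set" where
  "colim F \<V> = Sigma \<V> (ob F) //
     {(p, q). p \<in> Sigma \<V> (ob F) \<and> q \<in> Sigma \<V> (ob F) \<and> equivclp (colim_step F \<V>) p q}"

definition colim_map :: "'a precosheaf_data \<Rightarrow> real set \<Rightarrow> (real set \<times> 'a) set \<Rightarrow> 'a" where
  "colim_map F U c = the_elem ((\<lambda>(V, x). mor F V U x) ` c)"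

definition interval_cover :: "real set set \<Rightarrow> real set \<Rightarrow> bool" where
  "interval_cover \<V> U \<longleftrightarrow> (\<forall>V\<in>\<V>. open_interval V) \<and> \<Union>\<V> = U"

definition cosheaf :: "'a precosheaf_data \<Rightarrow> bool" where
  "cosheaf F \<longleftrightarrow> precosheaf F \<and>
     (\<forall>U \<V>. open_interval U \<and> interval_cover \<V> U \<and>
        (\<forall>V\<in>\<V>. \<forall>W\<in>\<V>. V \<inter> W \<noteq> {} \<longrightarrow> V \<inter> W \<in> \<V>) \<longrightarrow>
        bij_betw (colim_map F U) (colim F \<V>) (ob F U))"

definition constructible_cosheaf :: "'a precosheaf_data \<Rightarrow> real set \<Rightarrow> bool" where
  "constructible_cosheaf F S \<longleftrightarrow> cosheaf F \<and> finite S \<and>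
     (\<forall>U V. open_interval U \<and> open_interval V \<and> U \<subseteq> V \<and> S \<inter> U = S \<inter> V \<longrightarrow>
        bij_betw (mor F U V) (ob F U) (ob F V))"

definition precosheaf_iso :: "'a precosheaf_data \<Rightarrow> 'b precosheaf_data \<Rightarrow> bool" where
  "precosheaf_iso F G \<longleftrightarrow> (\<exists>\<eta>.
     (\<forall>U. open_interval U \<longrightarrow> bij_betw (\<eta> U) (ob F U) (ob G U)) \<and>
     (\<forall>U V. open_interval U \<and> open_interval V \<and> U \<subseteq> V \<longrightarrow>
        (\<forall>x\<in>ob F U. \<eta> V (mor F U V x) = mor G U V (\<eta> U x))))"


section \<open>Nice covers and the mapper functor\<close>

definition nice_cover :: "real set set \<Rightarrow> bool" where
  "nice_cover \<U> \<longleftrightarrow> interval_cover \<U> UNIV \<and>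
     (\<forall>\<T>. \<T> \<subseteq> \<U> \<and> \<T> \<noteq> {} \<and> \<Inter>\<T> \<noteq> {} \<longrightarrow> contractible (\<Inter>\<T>)) \<and>
     (\<forall>x. finite {V\<in>\<U>. x \<in> V})"

definition boundary_points :: "real set set \<Rightarrow> real set" where
  "boundary_points \<U> =
     {Inf V |V. V \<in> \<U> \<and> bdd_below V} \<union> {Sup V |V. V \<in> \<U> \<and> bdd_above V}"

definition mapper_interval :: "real set set \<Rightarrow> real set \<Rightarrow> real set" where
  "mapper_interval \<U> U = (\<Union>x\<in>U. \<Inter>{V\<in>\<U>. x \<in> V})"

definition mapper :: "real set set \<Rightarrow> 'a precosheaf_data \<Rightarrow> 'a precosheaf_data" where
  "mapper \<U> C =
     \<lparr>ob = (\<lambda>U. ob C (mapper_interval \<U> U)),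
      mor = (\<lambda>U V. mor C (mapper_interval \<U> U) (mapper_interval \<U> V))\<rparr>"


section \<open>Interleavings\<close>

text \<open>\<open>U = (a, b)\<close> is sent to \<open>(a - e, b + e)\<close>, where \<open>a\<close> and \<open>b\<close> may be infinite.\<close>

definition thicken :: "real \<Rightarrow> real set \<Rightarrow> real set" where
  "thicken e U = einterval (Inf (ereal ` U) - ereal e) (Sup (ereal ` U) + ereal e)"

definition interleaving ::
  "real \<Rightarrow> 'a precosheaf_data \<Rightarrow> 'b precosheaf_data \<Rightarrow>
   (real set \<Rightarrow> 'a \<Rightarrow> 'b) \<Rightarrow> (real set \<Rightarrow> 'b \<Rightarrow> 'a) \<Rightarrow> bool" where
  "interleaving e F G \<phi> \<psi> \<longleftrightarrow>
     (\<forall>U. open_interval U \<longrightarrow>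
        \<phi> U \<in> ob F U \<rightarrow> ob G (thicken e U) \<and> \<psi> U \<in> ob G U \<rightarrow> ob F (thicken e U)) \<and>
     (\<forall>U V. open_interval U \<and> open_interval V \<and> U \<subseteq> V \<longrightarrow>
        (\<forall>x\<in>ob F U. \<phi> V (mor F U V x) = mor G (thicken e U) (thicken e V) (\<phi> U x)) \<and>
        (\<forall>y\<in>ob G U. \<psi> V (mor G U V y) = mor F (thicken e U) (thicken e V) (\<psi> U y))) \<and>
     (\<forall>U. open_interval U \<longrightarrow>
        (\<forall>x\<in>ob F U. \<psi> (thicken e U) (\<phi> U x) = mor F U (thicken (2 * e) U) x) \<and>
        (\<forall>y\<in>ob G U. \<phi> (thicken e U) (\<psi> U y) = mor G U (thicken (2 * e) U) y))"

definition interleaving_distance ::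
  "'a precosheaf_data \<Rightarrow> 'b precosheaf_data \<Rightarrow> ennreal" where
  "interleaving_distance F G = Inf {ennreal e |e. 0 \<le> e \<and> (\<exists>\<phi> \<psi>. interleaving e F G \<phi> \<psi>)}"


section \<open>Constructible spaces over the real line and their Reeb cosheaves\<close>

inductive glue ::
  "nat \<Rightarrow> (nat \<Rightarrow> real) \<Rightarrow> (nat \<Rightarrow> 'v topology) \<Rightarrow> (nat \<Rightarrow> 'v \<Rightarrow> 'v) \<Rightarrow> (nat \<Rightarrow> 'v \<Rightarrow> 'v) \<Rightarrow>
   (nat + nat) \<times> ('v \<times> real) \<Rightarrow> (nat + nat) \<times> ('v \<times> real) \<Rightarrow> bool"
  for n a E l r where
  left: "i < n \<Longrightarrow> x \<in> topspace (E i) \<Longrightarrow> glue n a E l r (Inl i, (l i x, a i)) (Inr i, (x, a i))"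
| right: "i < n \<Longrightarrow> x \<in> topspace (E i) \<Longrightarrow>
    glue n a E l r (Inl (Suc i), (r i x, a (Suc i))) (Inr i, (x, a (Suc i)))"

text \<open>The summand \<open>Inl i\<close> is \<open>V i \<times> {a i}\<close>, the summand \<open>Inr i\<close> is \<open>E i \<times> [a i, a (i + 1)]\<close>.\<close>

definition pieces ::
  "nat \<Rightarrow> (nat \<Rightarrow> real) \<Rightarrow> (nat \<Rightarrow> 'v topology) \<Rightarrow> (nat \<Rightarrow> 'v topology) \<Rightarrow>
   ((nat + nat) \<times> ('v \<times> real)) topology" where
  "pieces n a V E = sum_topology
     (\<lambda>k. case k of
        Inl i \<Rightarrow> prod_topology (V i) (top_of_set {a i})
      | Inr i \<Rightarrow> prod_topology (E i) (top_of_set {a i..a (Suc i)}))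
     (Inl ` {..n} \<union> Inr ` {..<n})"

text \<open>The space \<open>X\<close> is identified with the quotient by a quotient map \<open>q\<close> whose fibres are the
  classes of the equivalence relation generated by \<^const>\<open>glue\<close>. The type argument is the carrier type
  of the spaces \<open>V i\<close> and \<open>E i\<close>; it has to be named because HOL has no existential quantification
  over types.\<close>

definition constructible_R_space :: "'v itself \<Rightarrow> 'x topology \<Rightarrow> ('x \<Rightarrow> real) \<Rightarrow> bool" where
  "constructible_R_space (_ :: 'v itself) X f \<longleftrightarrow> continuous_map X euclideanreal f \<and>
     (\<exists>n a (V :: nat \<Rightarrow> 'v topology) (E :: nat \<Rightarrow> 'v topology) l r q.
        (\<forall>i<n. a i < a (Suc i)) \<and>
        (\<forall>i\<le>n. locally_path_connected_space (V i)) \<and>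
        (\<forall>i<n. locally_path_connected_space (E i)) \<and>
        (\<forall>i<n. continuous_map (E i) (V i) (l i) \<and> continuous_map (E i) (V (Suc i)) (r i)) \<and>
        quotient_map (pieces n a V E) X q \<and>
        (\<forall>p\<in>topspace (pieces n a V E). \<forall>p'\<in>topspace (pieces n a V E).
           q p = q p' \<longleftrightarrow> equivclp (glue n a E l r) p p') \<and>
        (\<forall>(k, (x, t))\<in>topspace (pieces n a V E). f (q (k, (x, t))) = t))"

definition preimage_space :: "'x topology \<Rightarrow> ('x \<Rightarrow> real) \<Rightarrow> real set \<Rightarrow> 'x topology" where
  "preimage_space X f U = subtopology X {x \<in> topspace X. f x \<in> U}"

text \<open>The structure map sends a path component \<open>C\<close> to the path component containing it.\<close>

definition reeb_cosheaf :: "'x topology \<Rightarrow> ('x \<Rightarrow> real) \<Rightarrow> 'x set precosheaf_data" where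
  "reeb_cosheaf X f =
     \<lparr>ob = (\<lambda>U. path_components_of (preimage_space X f U)),
      mor = (\<lambda>U V C. \<Union>x\<in>C. path_component_of_set (preimage_space X f V) x)\<rparr>"

definition sup_dist :: "'x topology \<Rightarrow> ('x \<Rightarrow> real) \<Rightarrow> ('x \<Rightarrow> real) \<Rightarrow> ennreal" where
  "sup_dist X f g = (SUP x\<in>topspace X. ennreal \<bar>f x - g x\<bar>)"

end

theory Submission
  imports Defs
begin

text \<open>
  Let \<open>e < |s - b|\<close> for all critical values \<open>s\<close> and boundary points \<open>b\<close>, and let \<open>(\<phi>, \<psi>)\<close> be an
  \<open>e\<close>-interleaving of \<open>F\<close> and \<open>G\<close>. Every interval \<open>V = I(U)\<close> on which the mapper functor evaluates a
  cosheaf contains the same critical values as \<open>V\<close> thickened by \<open>e\<close>, so \<open>\<phi>\<close> and \<open>\<psi>\<close> can be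
  pulled back to unshifted natural maps \<open>F V \<rightarrow> G V \<rightarrow> F V\<close>. Their composite is the identity as soon
  as \<open>V\<close> can be eroded by \<open>e\<close>. This may fail for short \<open>V\<close>, but it holds for \<open>V = I(U')\<close> with \<open>U'\<close> the
  thickening of any \<open>U\<close> by \<open>e\<close>; hence the unshifted maps induce an \<open>e/2\<close>-interleaving of the mappers.
  Taking \<open>e\<close> close to the distance \<open>d\<close> of \<open>F\<close> and \<open>G\<close> bounds the distance of the mappers by about \<open>d/2\<close>.
  For Reeb cosheaves, \<open>d\<close> is at most the sup distance of the functions, because \<open>f -` U\<close> is
  contained in the preimage under \<open>g\<close> of a thickening of \<open>U\<close>.
\<close>

section \<open>Thickening and eroding intervals\<close>

lemma open_interval_iff: "open_interval U \<longleftrightarrow> open U \<and> is_interval U \<and> U \<noteq> {}"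
  by (simp add: open_interval_def is_interval_connected_1)

lemma open_interval_mem:
  assumes "open_interval U" "a \<in> U" "b \<in> U" "a \<le> x" "x \<le> b"
  shows "x \<in> U"
  using assms unfolding open_interval_iff is_interval_1 by blast

text \<open>Trades endpoint arithmetic in the extended reals for a metric description valid for
  bounded and unbounded intervals alike. Since \<open>U\<close> is open, its endpoints are not
  attained, so the non-strict bound still describes an open interval; \<open>e = 0\<close> is
  included.\<close>

lemma thicken_eq:
  assumes U: "open_interval U" and e: "0 \<le> e"
  shows "thicken e U = {x. \<exists>y\<in>U. \<bar>x - y\<bar> \<le> e}"
proof (intro set_eqI iffI)
  fix x assume "x \<in> thicken e U"
  then have "Inf (ereal ` U) - ereal e < ereal x" "ereal x < Sup (ereal ` U) + ereal e"
    by (auto simp: thicken_def einterval_def)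
  then have "Inf (ereal ` U) < ereal (x + e)" "ereal (x - e) < Sup (ereal ` U)"
    by (cases "Inf (ereal ` U)"; cases "Sup (ereal ` U)"; auto)+
  then obtain u v where uv: "u \<in> U" "u < x + e" "v \<in> U" "x - e < v"
    by (auto simp: Inf_less_iff less_Sup_iff)
  show "x \<in> {x. \<exists>y\<in>U. \<bar>x - y\<bar> \<le> e}"
  \<comment> \<open>Either \<open>u\<close> itself is within \<open>e\<close> of \<open>x\<close>,
    or \<open>x - e\<close> lies between \<open>u\<close> and \<open>v\<close> and is in
    \<open>U\<close> by convexity.\<close>
  proof (cases "x - e < u")
    case True
    with uv have "\<bar>x - u\<bar> \<le> e" by auto
    with uv show ?thesis by blast
  next
    case False
    with uv have "x - e \<in> U"
      by (intro open_interval_mem[OF U uv(1,3)]) auto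
    then show ?thesis using e by (auto intro!: bexI[of _ "x - e"])
  qed
next
  fix x assume "x \<in> {x. \<exists>y\<in>U. \<bar>x - y\<bar> \<le> e}"
  then obtain y where y: "y \<in> U" "\<bar>x - y\<bar> \<le> e" by blast
  \<comment> \<open>The room \<open>r\<close> around \<open>y\<close> turns the weak bounds by
    infimum and supremum into the strict ones that membership requires.\<close>
  obtain r where r: "0 < r" "cball y r \<subseteq> U"
    using U y open_contains_cball unfolding open_interval_def by blast
  then have "y - r \<in> U" "y + r \<in> U"
    by (auto simp: subset_iff dist_real_def)
  then have "Inf (ereal ` U) \<le> ereal (y - r)" "ereal (y + r) \<le> Sup (ereal ` U)"
    by (auto intro: Inf_lower Sup_upper)
  then have "Inf (ereal ` U) - ereal e \<le> ereal (y - r) - ereal e"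
    "ereal (y + r) + ereal e \<le> Sup (ereal ` U) + ereal e"
    by (simp_all only: ereal_minus_mono add_right_mono order_refl)
  moreover have "ereal (y - r) - ereal e < ereal x" "ereal x < ereal (y + r) + ereal e"
    using y r by auto
  ultimately show "x \<in> thicken e U"
    unfolding thicken_def einterval_def
    by (auto intro: le_less_trans[where y = "ereal (y - r - e)"] less_le_trans[where y = "ereal (y + r + e)"])
qed

lemma subset_thicken: "open_interval U \<Longrightarrow> 0 \<le> e \<Longrightarrow> U \<subseteq> thicken e U"
  by (force simp: thicken_eq)

lemma thicken_mono:
  "open_interval U \<Longrightarrow> open_interval V \<Longrightarrow> U \<subseteq> V \<Longrightarrow> 0 \<le> e \<Longrightarrow> thicken e U \<subseteq> thicken e V"
  by (force simp: thicken_eq)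

lemma open_interval_thicken:
  assumes U: "open_interval U" and e: "0 \<le> e"
  shows "open_interval (thicken e U)"
proof -
  have "connected (thicken e U)"
    unfolding thicken_def is_interval_connected_1[symmetric]
    by (auto simp: is_interval_1 einterval_def elim: less_le_trans le_less_trans
        intro: less_le_trans[where y = "ereal _"] le_less_trans[where y = "ereal _"])
  moreover have "open (thicken e U)" by (simp add: thicken_def)
  moreover have "thicken e U \<noteq> {}"
    using subset_thicken[OF U e] U by (auto simp: open_interval_def)
  ultimately show ?thesis by (simp add: open_interval_def)
qed

lemma thicken_thicken:
  assumes U: "open_interval U" and e: "0 \<le> e" and d: "0 \<le> d"
  shows "thicken d (thicken e U) = thicken (e + d) U"
proof -
  \<comment> \<open>The non-trivial half of the semigroup law: from \<open>y\<close>, walk towards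
    \<open>x\<close> by at most \<open>e\<close>, stopping at \<open>x\<close> if it is reached; at
    most \<open>d\<close> remains.\<close>
  have "\<exists>z. (\<exists>y\<in>U. \<bar>z - y\<bar> \<le> e) \<and> \<bar>x - z\<bar> \<le> d" if "y \<in> U" "\<bar>x - y\<bar> \<le> e + d" for x y
  proof (cases "x \<le> y")
    case True
    then show ?thesis using that e d
      by (intro exI[of _ "max (y - e) x"]) (auto intro!: bexI[of _ y])
  next
    case False
    then show ?thesis using that e d
      by (intro exI[of _ "min (y + e) x"]) (auto intro!: bexI[of _ y])
  qed
  moreover have "\<bar>x - y\<bar> \<le> e + d" if "\<bar>z - y\<bar> \<le> e" "\<bar>x - z\<bar> \<le> d" for x y z
    using that by linarith
  ultimately show ?thesis
    unfolding thicken_eq[OF open_interval_thicken[OF U e] d]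
    unfolding thicken_eq[OF U e] thicken_eq[OF U add_nonneg_nonneg[OF e d]] by blast
qed

section \<open>Erosion of intervals\<close>

text \<open>The inner parallel set: for an interval and \<open>e \<ge> 0\<close>, testing the two
  points at distance \<open>e\<close> covers the whole closed ball by convexity.\<close>

definition erode :: "real \<Rightarrow> real set \<Rightarrow> real set" where
  "erode e V = {x. x - e \<in> V \<and> x + e \<in> V}"

lemma erode_subset: "open_interval V \<Longrightarrow> 0 \<le> e \<Longrightarrow> erode e V \<subseteq> V"
  by (auto simp: erode_def intro: open_interval_mem[of V "_ - e" "_ + e"])

lemma open_interval_erode:
  assumes V: "open_interval V" and ne: "erode e V \<noteq> {}"
  shows "open_interval (erode e V)"
proof -
  have "erode e V = (\<lambda>x. x - e) -` V \<inter> (\<lambda>x. x + e) -` V"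
    by (auto simp: erode_def)
  moreover have "open \<dots>"
  proof (intro open_Int open_vimage)
    show "open V" "open V" using V by (simp_all add: open_interval_def)
    show "continuous_on UNIV (\<lambda>x. x - e)" "continuous_on UNIV (\<lambda>x. x + e)"
      by (intro continuous_intros)+
  qed
  moreover have "is_interval (erode e V)"
    unfolding is_interval_1
  proof (intro ballI allI impI)
    fix a b x assume ab: "a \<in> erode e V" "b \<in> erode e V" "a \<le> x \<and> x \<le> b"
    have "x - e \<in> V"
      by (rule open_interval_mem[OF V, of "a - e" "b - e"]) (use ab in \<open>auto simp: erode_def\<close>)
    moreover have "x + e \<in> V"
      by (rule open_interval_mem[OF V, of "a + e" "b + e"]) (use ab in \<open>auto simp: erode_def\<close>)
    ultimately show "x \<in> erode e V" by (simp add: erode_def)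
  qed
  ultimately show ?thesis using ne by (simp add: open_interval_iff)
qed

text \<open>Nonemptiness of the erosion means that \<open>V\<close> is longer than
  \<open>2 * e\<close>; shrinking it at both ends can then be undone exactly.\<close>

lemma thicken_erode:
  assumes V: "open_interval V" and e: "0 \<le> e" and ne: "erode e V \<noteq> {}"
  shows "thicken e (erode e V) = V"
proof (intro set_eqI iffI)
  fix y assume "y \<in> thicken e (erode e V)"
  then obtain x where "x - e \<in> V" "x + e \<in> V" "\<bar>y - x\<bar> \<le> e"
    unfolding thicken_eq[OF open_interval_erode[OF V ne] e] unfolding erode_def by blast
  then show "y \<in> V" using open_interval_mem[OF V, of "x - e" "x + e" y] by linarith
next
  fix y assume y: "y \<in> V"
  obtain x where x: "x - e \<in> V" "x + e \<in> V" using ne by (auto simp: erode_def)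
  \<comment> \<open>A point \<open>y\<close> far from the eroded point \<open>x\<close> is moved by
    \<open>e\<close> towards \<open>x\<close>. The result is in the erosion, because a further step
    of \<open>e\<close> does not pass \<open>x - e\<close> or \<open>x + e\<close>
    respectively.\<close>
  consider "\<bar>y - x\<bar> \<le> e" | "y > x + e" | "y < x - e" by linarith
  then have "\<exists>z\<in>erode e V. \<bar>y - z\<bar> \<le> e"
  proof cases
    case 1
    then show ?thesis using x by (intro bexI[of _ x]) (simp_all add: erode_def)
  next
    case 2
    have "y - e - e \<in> V" by (rule open_interval_mem[OF V x(1) y]) (use 2 e in auto)
    then show ?thesis using y e by (intro bexI[of _ "y - e"]) (simp_all add: erode_def)
  next
    case 3
    have "y + e + e \<in> V" by (rule open_interval_mem[OF V y x(2)]) (use 3 e in auto)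
    then show ?thesis using y e by (intro bexI[of _ "y + e"]) (simp_all add: erode_def)
  qed
  then show "y \<in> thicken e (erode e V)"
    by (simp add: thicken_eq[OF open_interval_erode[OF V ne] e])
qed

section \<open>Interleavings\<close>

lemma precosheaf_mor_in:
  "precosheaf F \<Longrightarrow> open_interval U \<Longrightarrow> open_interval V \<Longrightarrow> U \<subseteq> V \<Longrightarrow> x \<in> ob F U \<Longrightarrow>
    mor F U V x \<in> ob F V"
  by (auto simp: precosheaf_def Pi_iff)

lemma precosheaf_mor_comp:
  "precosheaf F \<Longrightarrow> open_interval U \<Longrightarrow> open_interval V \<Longrightarrow> open_interval W \<Longrightarrow> U \<subseteq> V \<Longrightarrow> V \<subseteq> W \<Longrightarrow>
    x \<in> ob F U \<Longrightarrow> mor F V W (mor F U V x) = mor F U W x"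
  by (simp add: precosheaf_def)

text \<open>One of the two families of an interleaving. Splitting an interleaving into two symmetric
  halves lets each half be treated once and reused with \<open>F\<close> and \<open>G\<close>
  exchanged.\<close>

definition shift_map ::
  "real \<Rightarrow> 'a precosheaf_data \<Rightarrow> 'b precosheaf_data \<Rightarrow> (real set \<Rightarrow> 'a \<Rightarrow> 'b) \<Rightarrow> bool" where
  "shift_map e F G \<phi> \<longleftrightarrow>
     (\<forall>U x. open_interval U \<longrightarrow> x \<in> ob F U \<longrightarrow> \<phi> U x \<in> ob G (thicken e U)) \<and>
     (\<forall>U V x. open_interval U \<longrightarrow> open_interval V \<longrightarrow> U \<subseteq> V \<longrightarrow> x \<in> ob F U \<longrightarrow>
        \<phi> V (mor F U V x) = mor G (thicken e U) (thicken e V) (\<phi> U x))"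

definition retracts_shift ::
  "real \<Rightarrow> 'a precosheaf_data \<Rightarrow> (real set \<Rightarrow> 'a \<Rightarrow> 'b) \<Rightarrow> (real set \<Rightarrow> 'b \<Rightarrow> 'a) \<Rightarrow> bool" where
  "retracts_shift e F \<phi> \<psi> \<longleftrightarrow> (\<forall>U x. open_interval U \<longrightarrow> x \<in> ob F U \<longrightarrow>
     \<psi> (thicken e U) (\<phi> U x) = mor F U (thicken (2 * e) U) x)"

lemma interleaving_iff:
  "interleaving e F G \<phi> \<psi> \<longleftrightarrow>
     shift_map e F G \<phi> \<and> shift_map e G F \<psi> \<and> retracts_shift e F \<phi> \<psi> \<and> retracts_shift e G \<psi> \<phi>"
  by (simp add: interleaving_def shift_map_def retracts_shift_def Pi_iff Ball_def all_conj_distrib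
      imp_conjR imp_conjL) (simp only: conj_ac)

lemma shift_mapD:
  assumes "shift_map e F G \<phi>"
  shows "open_interval U \<Longrightarrow> x \<in> ob F U \<Longrightarrow> \<phi> U x \<in> ob G (thicken e U)"
    and "open_interval U \<Longrightarrow> open_interval V \<Longrightarrow> U \<subseteq> V \<Longrightarrow> x \<in> ob F U \<Longrightarrow>
      \<phi> V (mor F U V x) = mor G (thicken e U) (thicken e V) (\<phi> U x)"
  using assms by (simp_all add: shift_map_def)

lemma retracts_shiftD:
  "retracts_shift e F \<phi> \<psi> \<Longrightarrow> open_interval U \<Longrightarrow> x \<in> ob F U \<Longrightarrow>
     \<psi> (thicken e U) (\<phi> U x) = mor F U (thicken (2 * e) U) x"
  by (simp add: retracts_shift_def)

lemma interleaving_distance_le: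
  "0 \<le> e \<Longrightarrow> interleaving e F G \<phi> \<psi> \<Longrightarrow> interleaving_distance F G \<le> ennreal e"
  unfolding interleaving_distance_def by (rule Inf_lower) auto

lemma interleaving_distance_lessE:
  assumes "interleaving_distance F G < c"
  obtains e \<phi> \<psi> where "0 \<le> e" "ennreal e < c" "interleaving e F G \<phi> \<psi>"
  using assms unfolding interleaving_distance_def Inf_less_iff by auto

section \<open>Stable intervals\<close>

text \<open>Says that critical values stay more than \<open>e\<close> away from crossing an
  endpoint, without naming endpoints, which may be infinite. Phrased through membership, the
  condition passes to unions and intersections.\<close>

definition stable_interval :: "real set \<Rightarrow> real \<Rightarrow> real set \<Rightarrow> bool" where
  "stable_interval S e V \<longleftrightarrow> open_interval V \<and> (\<forall>s\<in>S. \<forall>t. \<bar>t\<bar> \<le> e \<longrightarrow> (s + t \<in> V \<longleftrightarrow> s \<in> V))"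

lemma stable_intervalD: "stable_interval S e V \<Longrightarrow> s \<in> S \<Longrightarrow> \<bar>t\<bar> \<le> e \<Longrightarrow> s + t \<in> V \<longleftrightarrow> s \<in> V"
  by (simp add: stable_interval_def)

lemma constructible_cosheaf_precosheaf: "constructible_cosheaf F S \<Longrightarrow> precosheaf F"
  by (simp add: constructible_cosheaf_def cosheaf_def)

text \<open>By stability, thickening by \<open>e\<close> takes in no new critical value, so
  constructibility applies.\<close>

lemma bij_betw_mor_thicken:
  assumes F: "constructible_cosheaf F S" and V: "stable_interval S e V" and e: "0 \<le> e"
  shows "bij_betw (mor F V (thicken e V)) (ob F V) (ob F (thicken e V))"
proof -
  have oV: "open_interval V" using V by (simp add: stable_interval_def)
  have "s \<in> V" if "s \<in> S" "y \<in> V" "\<bar>s - y\<bar> \<le> e" for s y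
  proof -
    have "s + (y - s) \<in> V \<longleftrightarrow> s \<in> V"
      using that by (intro stable_intervalD[OF V]) auto
    then show ?thesis using that by simp
  qed
  then have "S \<inter> V = S \<inter> thicken e V"
    using subset_thicken[OF oV e] by (auto simp: thicken_eq[OF oV e])
  then show ?thesis
    using F oV open_interval_thicken[OF oV e] subset_thicken[OF oV e]
    unfolding constructible_cosheaf_def by blast
qed

text \<open>By stability, eroding by \<open>e\<close> loses no critical value, so constructibility
  applies.\<close>

lemma bij_betw_mor_erode:
  assumes F: "constructible_cosheaf F S" and V: "stable_interval S e V" and e: "0 \<le> e"
    and ne: "erode e V \<noteq> {}"
  shows "bij_betw (mor F (erode e V) V) (ob F (erode e V)) (ob F V)"
proof -
  have oV: "open_interval V" using V by (simp add: stable_interval_def)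
  have "s - e \<in> V \<and> s + e \<in> V" if "s \<in> S" "s \<in> V" for s
  proof -
    have "s + e \<in> V \<longleftrightarrow> s \<in> V" "s + (- e) \<in> V \<longleftrightarrow> s \<in> V"
      using that e by (intro stable_intervalD[OF V]; simp)+
    then show ?thesis using that by simp
  qed
  then have "S \<inter> erode e V = S \<inter> V"
    using erode_subset[OF oV e] by (auto simp: erode_def)
  then show ?thesis
    using F oV open_interval_erode[OF oV ne] erode_subset[OF oV e]
    unfolding constructible_cosheaf_def by blast
qed

text \<open>Meaningful only on stable intervals \<open>V\<close>, where the structure map being inverted is bijective.\<close>

definition unshift ::
  "real \<Rightarrow> 'b precosheaf_data \<Rightarrow> (real set \<Rightarrow> 'a \<Rightarrow> 'b) \<Rightarrow> real set \<Rightarrow> 'a \<Rightarrow> 'b" where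
  "unshift e G \<phi> V x = inv_into (ob G V) (mor G V (thicken e V)) (\<phi> V x)"

lemma unshift:
  assumes G: "constructible_cosheaf G S" and \<phi>: "shift_map e F G \<phi>"
    and V: "stable_interval S e V" and e: "0 \<le> e" and x: "x \<in> ob F V"
  shows "unshift e G \<phi> V x \<in> ob G V"
    and "mor G V (thicken e V) (unshift e G \<phi> V x) = \<phi> V x"
proof -
  have "\<phi> V x \<in> ob G (thicken e V)"
    using shift_mapD(1)[OF \<phi> _ x] V by (simp add: stable_interval_def)
  then have im: "\<phi> V x \<in> mor G V (thicken e V) ` ob G V"
    using bij_betw_mor_thicken[OF G V e] by (simp add: bij_betw_def)
  show "unshift e G \<phi> V x \<in> ob G V"
    unfolding unshift_def using im by (rule inv_into_into)
  show "mor G V (thicken e V) (unshift e G \<phi> V x) = \<phi> V x"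
    unfolding unshift_def using im by (rule f_inv_into_f)
qed

text \<open>The structure map of \<open>G\<close> from \<open>V\<close> to
  \<open>thicken e V\<close> is injective, so naturality may be checked after applying it, where it
  becomes naturality of \<open>\<phi>\<close>.\<close>

lemma unshift_natural:
  assumes F: "constructible_cosheaf F S" and G: "constructible_cosheaf G S"
    and \<phi>: "shift_map e F G \<phi>"
    and U: "stable_interval S e U" and V: "stable_interval S e V" and UV: "U \<subseteq> V" and e: "0 \<le> e" and x: "x \<in> ob F U"
  shows "unshift e G \<phi> V (mor F U V x) = mor G U V (unshift e G \<phi> U x)"
proof -
  note pF = constructible_cosheaf_precosheaf[OF F] and pG = constructible_cosheaf_precosheaf[OF G]
  have oU: "open_interval U" and oV: "open_interval V" using U V by (auto simp: stable_interval_def)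
  note tU = open_interval_thicken[OF oU e] and tV = open_interval_thicken[OF oV e]
  note y = unshift[OF G \<phi> U e x]
  note z = unshift[OF G \<phi> V e precosheaf_mor_in[OF pF oU oV UV x]]
  have "mor G V (thicken e V) (mor G U V (unshift e G \<phi> U x)) = mor G U (thicken e V) (unshift e G \<phi> U x)"
    by (rule precosheaf_mor_comp[OF pG oU oV tV UV subset_thicken[OF oV e] y(1)])
  also have "\<dots> = mor G (thicken e U) (thicken e V) (mor G U (thicken e U) (unshift e G \<phi> U x))"
    by (rule precosheaf_mor_comp[symmetric, OF pG oU tU tV subset_thicken[OF oU e]
          thicken_mono[OF oU oV UV e] y(1)])
  also have "\<dots> = mor G V (thicken e V) (unshift e G \<phi> V (mor F U V x))"
    by (simp add: y(2) z(2) shift_mapD(2)[OF \<phi> oU oV UV x])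
  finally show ?thesis
    using bij_betw_mor_thicken[OF G V e] z(1) precosheaf_mor_in[OF pG oU oV UV y(1)]
    by (metis bij_betw_def inj_onD)
qed

text \<open>Pull \<open>x\<close> back to the erosion \<open>E\<close>. There \<open>\<phi>\<close>
  lands in \<open>G\<close> of \<open>thicken e E = V\<close> itself, so \<open>\<psi>\<close> can
  be applied to it directly and the interleaving identity for \<open>E\<close> becomes
  available.\<close>

lemma unshift_unshift:
  assumes F: "constructible_cosheaf F S" and G: "constructible_cosheaf G S"
    and \<phi>: "shift_map e F G \<phi>" and \<psi>: "shift_map e G F \<psi>" and ret: "retracts_shift e F \<phi> \<psi>"
    and V: "stable_interval S e V" and ne: "erode e V \<noteq> {}" and e: "0 \<le> e" and x: "x \<in> ob F V"
  shows "unshift e F \<psi> V (unshift e G \<phi> V x) = x"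
proof -
  note pF = constructible_cosheaf_precosheaf[OF F]
  have oV: "open_interval V" using V by (auto simp: stable_interval_def)
  define E where "E = erode e V"
  have oE: "open_interval E" and EV: "E \<subseteq> V" and tE: "thicken e E = V"
    using oV e ne by (auto simp: E_def open_interval_erode thicken_erode dest: erode_subset)
  have t2E: "thicken (2 * e) E = thicken e V"
    using thicken_thicken[OF oE e e] tE by simp
  obtain x0 where x0: "x0 \<in> ob F E" "x = mor F E V x0"
    using bij_betw_mor_erode[OF F V e ne] x unfolding E_def bij_betw_def by auto
  note y = unshift[OF G \<phi> V e x]
  note z = unshift[OF F \<psi> V e y(1)]
  have p: "\<phi> E x0 \<in> ob G V" using shift_mapD(1)[OF \<phi> oE x0(1)] tE by simp
  have "mor G V (thicken e V) (unshift e G \<phi> V x) = mor G V (thicken e V) (\<phi> E x0)"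
    using shift_mapD(2)[OF \<phi> oE oV EV x0(1)] y(2) x0(2) tE by simp
  \<comment> \<open>Both sides lie in \<open>ob G V\<close> and agree after the injective structure
    map into \<open>thicken e V\<close>.\<close>
  then have "unshift e G \<phi> V x = \<phi> E x0"
    using bij_betw_mor_thicken[OF G V e] y(1) p by (metis bij_betw_def inj_onD)
  then have "mor F V (thicken e V) (unshift e F \<psi> V (unshift e G \<phi> V x)) = \<psi> V (\<phi> E x0)"
    using z(2) by simp
  also have "\<dots> = mor F E (thicken e V) x0"
    using retracts_shiftD[OF ret oE x0(1)] by (simp add: tE t2E)
  also have "\<dots> = mor F V (thicken e V) x"
    using precosheaf_mor_comp[OF pF oE oV open_interval_thicken[OF oV e] EV subset_thicken[OF oV e] x0(1)]
      x0(2) by simp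
  finally show ?thesis
    using bij_betw_mor_thicken[OF F V e] z(1) x by (metis bij_betw_def inj_onD)
qed

section \<open>The mapper functor\<close>

lemma subset_mapper_interval: "U \<subseteq> mapper_interval \<U> U"
  by (auto simp: mapper_interval_def)

lemma mapper_interval_mono: "U \<subseteq> V \<Longrightarrow> mapper_interval \<U> U \<subseteq> mapper_interval \<U> V"
  by (auto simp: mapper_interval_def)

text \<open>Openness comes from the local finiteness of the cover: each piece is a finite
  intersection of open sets.\<close>

lemma open_interval_mapper_interval:
  assumes \<U>: "nice_cover \<U>" and U: "open_interval U"
  shows "open_interval (mapper_interval \<U> U)"
proof -
  have oi: "open_interval V" if "V \<in> \<U>" for V
    using \<U> that by (auto simp: nice_cover_def interval_cover_def)
  have int: "is_interval (\<Inter>{V \<in> \<U>. x \<in> V})" for x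
    using oi open_interval_mem unfolding is_interval_1 by blast
  have "open (mapper_interval \<U> U)"
    unfolding mapper_interval_def
    using \<U> oi by (intro open_UN ballI open_Inter) (auto simp: nice_cover_def open_interval_def)
  moreover have "connected (mapper_interval \<U> U)"
  proof -
    \<comment> \<open>Adjoining \<open>U\<close> to each piece does not change the union, and makes
      the pieces connected sets with the common nonempty part \<open>U\<close>.\<close>
    have eq: "mapper_interval \<U> U = (\<Union>x\<in>U. U \<union> \<Inter>{V \<in> \<U>. x \<in> V})"
      by (auto simp: mapper_interval_def)
    have "connected (U \<union> \<Inter>{V \<in> \<U>. x \<in> V})" if "x \<in> U" for x
      using that U int[of x]
      by (intro connected_Un) (auto simp: open_interval_def is_interval_connected_1)
    then show ?thesis
      unfolding eq using U by (intro connected_Union) (auto simp: open_interval_def)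
  qed
  moreover have "mapper_interval \<U> U \<noteq> {}"
    using subset_mapper_interval[of U \<U>] U by (auto simp: open_interval_def)
  ultimately show ?thesis by (simp add: open_interval_def)
qed

text \<open>Whether a point lies in the mapper interval depends only on which cover elements contain
  it. So it suffices that a move of at most \<open>e\<close> from a critical value changes
  membership in no single cover element.\<close>

lemma stable_mapper_interval:
  assumes \<U>: "nice_cover \<U>" and U: "open_interval U"
    and far: "\<And>s b. s \<in> S \<Longrightarrow> b \<in> boundary_points \<U> \<Longrightarrow> e < \<bar>s - b\<bar>"
  shows "stable_interval S e (mapper_interval \<U> U)"
proof -
  \<comment> \<open>If \<open>A\<close> contained \<open>p\<close> but not \<open>q\<close>, an
    endpoint of \<open>A\<close> would lie between them, hence within \<open>e\<close> of
    \<open>s\<close>, contradicting \<open>far\<close>. Keeping \<open>p\<close> and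
    \<open>q\<close> both general covers leaving \<open>s\<close> and returning to it.\<close>
  have no_exit: "q \<in> A" if s: "s \<in> S" and A: "A \<in> \<U>" and p: "p \<in> A" "\<bar>p - s\<bar> \<le> e" "\<bar>q - s\<bar> \<le> e"
    for s A p q
  proof (rule ccontr)
    assume q: "q \<notin> A"
    have oA: "open_interval A" using \<U> A by (auto simp: nice_cover_def interval_cover_def)
    show False
    proof (cases "p \<le> q")
      case True
      have ub: "x \<le> q" if "x \<in> A" for x
        using open_interval_mem[OF oA p(1) that True] q by fastforce
      then have bdd: "bdd_above A" by (auto simp: bdd_above_def)
      have "p \<le> Sup A" "Sup A \<le> q"
        using ub p bdd by (auto intro: cSup_upper cSup_least)
      moreover have "Sup A \<in> boundary_points \<U>" using A bdd by (auto simp: boundary_points_def)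
      ultimately show False using far[OF s, of "Sup A"] p by auto
    next
      case False
      have lb: "q \<le> x" if "x \<in> A" for x
        using open_interval_mem[OF oA that p(1), of q] False q by fastforce
      then have bdd: "bdd_below A" by (auto simp: bdd_below_def)
      have "Inf A \<le> p" "q \<le> Inf A"
        using lb p bdd by (auto intro: cInf_lower cInf_greatest)
      moreover have "Inf A \<in> boundary_points \<U>" using A bdd by (auto simp: boundary_points_def)
      ultimately show False using far[OF s, of "Inf A"] p by auto
    qed
  qed
  have "s + t \<in> A \<longleftrightarrow> s \<in> A" if "s \<in> S" "A \<in> \<U>" "\<bar>t\<bar> \<le> e" for s t A
    using no_exit[OF that(1,2), of s "s + t"] no_exit[OF that(1,2), of "s + t" s] that(3) by auto
  then show ?thesis
    using open_interval_mapper_interval[OF \<U> U]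
    unfolding stable_interval_def mapper_interval_def by blast
qed

section \<open>Interleaving the mappers with half the shift\<close>

lemma mapper_simps [simp]:
  "ob (mapper \<U> F) U = ob F (mapper_interval \<U> U)"
  "mor (mapper \<U> F) U V = mor F (mapper_interval \<U> U) (mapper_interval \<U> V)"
  by (simp_all add: mapper_def)

text \<open>The unshifted map followed by a structure map that adds the shift. Half of
  \<open>e\<close> is chosen because two such shifts add up to \<open>e\<close>, which makes the
  target interval long enough to erode by \<open>e\<close>.\<close>

definition mapper_shift ::
  "real set set \<Rightarrow> real \<Rightarrow> 'b precosheaf_data \<Rightarrow> (real set \<Rightarrow> 'a \<Rightarrow> 'b) \<Rightarrow> real set \<Rightarrow> 'a \<Rightarrow> 'b" where
  "mapper_shift \<U> e G \<phi> U x =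
     mor G (mapper_interval \<U> U) (mapper_interval \<U> (thicken (e / 2) U))
       (unshift e G \<phi> (mapper_interval \<U> U) x)"

lemma shift_map_mapper_shift:
  assumes F: "constructible_cosheaf F S" and G: "constructible_cosheaf G S"
    and \<U>: "nice_cover \<U>"
    and far: "\<And>s b. s \<in> S \<Longrightarrow> b \<in> boundary_points \<U> \<Longrightarrow> e < \<bar>s - b\<bar>"
    and e: "0 \<le> e" and \<phi>: "shift_map e F G \<phi>"
  shows "shift_map (e / 2) (mapper \<U> F) (mapper \<U> G) (mapper_shift \<U> e G \<phi>)"
proof -
  let ?I = "mapper_interval \<U>" and ?T = "thicken (e / 2)"
  note pF = constructible_cosheaf_precosheaf[OF F] and pG = constructible_cosheaf_precosheaf[OF G]
  note oI = open_interval_mapper_interval[OF \<U>] and st = stable_mapper_interval[OF \<U> _ far]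
  have e2: "0 \<le> e / 2" using e by simp
  have T: "open_interval (?T U)" "?I U \<subseteq> ?I (?T U)" if "open_interval U" for U
    using that e2 by (auto intro!: open_interval_thicken dest: mapper_interval_mono[OF subset_thicken[OF that e2], THEN subsetD])
  show ?thesis
    unfolding shift_map_def mapper_simps
  proof (intro conjI allI impI)
    fix U x assume U: "open_interval U" and x: "x \<in> ob F (?I U)"
    show "mapper_shift \<U> e G \<phi> U x \<in> ob G (?I (?T U))"
      unfolding mapper_shift_def
      using unshift(1)[OF G \<phi> st[OF U] e x] U T[OF U] oI by (auto intro: precosheaf_mor_in[OF pG])
  next
    fix U V x assume U: "open_interval U" and V: "open_interval V" and UV: "U \<subseteq> V" and x: "x \<in> ob F (?I U)"
    let ?y = "unshift e G \<phi> (?I U) x"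
    have y: "?y \<in> ob G (?I U)" by (rule unshift(1)[OF G \<phi> st[OF U] e x])
    note IUV = mapper_interval_mono[OF UV, of \<U>]
    \<comment> \<open>Both composites equal the structure map from \<open>?I U\<close> to
      \<open>?I (?T V)\<close>, by functoriality.\<close>
    have "mor G (?I V) (?I (?T V)) (mor G (?I U) (?I V) ?y) = mor G (?I U) (?I (?T V)) ?y"
      using U V T y oI IUV by (intro precosheaf_mor_comp[OF pG]) auto
    also have "\<dots> = mor G (?I (?T U)) (?I (?T V)) (mor G (?I U) (?I (?T U)) ?y)"
      using U V T y oI mapper_interval_mono[OF thicken_mono[OF U V UV e2], of \<U>]
      by (intro precosheaf_mor_comp[OF pG, symmetric]) auto
    finally show "mapper_shift \<U> e G \<phi> V (mor F (?I U) (?I V) x) =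
        mor G (?I (?T U)) (?I (?T V)) (mapper_shift \<U> e G \<phi> U x)"
      by (simp add: mapper_shift_def unshift_natural[OF F G \<phi> st[OF U] st[OF V] IUV e x])
  qed
qed

text \<open>The point is that \<open>mapper_interval \<U> (thicken e U)\<close> is long enough to be eroded by \<open>e\<close>, even
  if \<open>mapper_interval \<U> U\<close> is not, so \<open>unshift_unshift\<close> applies to it.\<close>

lemma retracts_shift_mapper_shift:
  assumes F: "constructible_cosheaf F S" and G: "constructible_cosheaf G S"
    and \<U>: "nice_cover \<U>"
    and far: "\<And>s b. s \<in> S \<Longrightarrow> b \<in> boundary_points \<U> \<Longrightarrow> e < \<bar>s - b\<bar>"
    and e: "0 \<le> e" and \<phi>: "shift_map e F G \<phi>" and \<psi>: "shift_map e G F \<psi>"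
    and ret: "retracts_shift e F \<phi> \<psi>"
  shows "retracts_shift (e / 2) (mapper \<U> F) (mapper_shift \<U> e G \<phi>) (mapper_shift \<U> e F \<psi>)"
  unfolding retracts_shift_def mapper_simps
proof (intro allI impI)
  let ?I = "mapper_interval \<U>"
  note pF = constructible_cosheaf_precosheaf[OF F] and pG = constructible_cosheaf_precosheaf[OF G]
  note oI = open_interval_mapper_interval[OF \<U>] and st = stable_mapper_interval[OF \<U> _ far]
  have e2: "0 \<le> e / 2" using e by simp
  fix U x assume U: "open_interval U" and x: "x \<in> ob F (?I U)"
  define T where "T = thicken (e / 2) U"
  have oT: "open_interval T" unfolding T_def by (rule open_interval_thicken[OF U e2])
  have TT: "thicken (e / 2) T = thicken e U"
    unfolding T_def using thicken_thicken[OF U e2 e2] by simp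
  define W where "W = thicken e U"
  have oW: "open_interval W" unfolding W_def by (rule open_interval_thicken[OF U e])
  have sub: "?I U \<subseteq> ?I T" "?I T \<subseteq> ?I W" "?I U \<subseteq> ?I W"
    unfolding T_def W_def TT[symmetric]
    using subset_thicken[OF U e2] subset_thicken[OF oT e2] T_def by (auto intro!: mapper_interval_mono)
  \<comment> \<open>Any \<open>u\<close> in \<open>U\<close> survives the erosion, since
    \<open>u - e\<close> and \<open>u + e\<close> both lie in \<open>W\<close>.\<close>
  obtain u where u: "u \<in> U" using U by (auto simp: open_interval_def)
  then have "u - e \<in> W" "u + e \<in> W"
    unfolding W_def thicken_eq[OF U e] using e by (auto intro!: bexI[of _ u])
  then have ne: "erode e (?I W) \<noteq> {}"
    using subset_mapper_interval[of W \<U>] by (auto simp: erode_def)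
  let ?y = "unshift e G \<phi> (?I U) x"
  have y: "?y \<in> ob G (?I U)" by (rule unshift(1)[OF G \<phi> st[OF U] e x])
  let ?z = "unshift e F \<psi> (?I U) ?y"
  have "mapper_shift \<U> e F \<psi> T (mapper_shift \<U> e G \<phi> U x) =
      mor F (?I T) (?I W) (unshift e F \<psi> (?I T) (mor G (?I U) (?I T) ?y))"
    by (simp add: mapper_shift_def TT T_def[symmetric] W_def)
  \<comment> \<open>Naturality pushes both unshifted maps to \<open>?I W\<close>, where their
    composite cancels.\<close>
  also have "\<dots> = unshift e F \<psi> (?I W) (mor G (?I T) (?I W) (mor G (?I U) (?I T) ?y))"
    using oT oW U oI sub y
    by (intro unshift_natural[OF G F \<psi> st st _ e, symmetric] precosheaf_mor_in[OF pG]) auto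
  also have "\<dots> = unshift e F \<psi> (?I W) (mor G (?I U) (?I W) ?y)"
    using oT oW U oI sub y by (subst precosheaf_mor_comp[OF pG]) auto
  also have "\<dots> = unshift e F \<psi> (?I W) (unshift e G \<phi> (?I W) (mor F (?I U) (?I W) x))"
    by (simp add: unshift_natural[OF F G \<phi> st[OF U] st[OF oW] sub(3) e x])
  also have "\<dots> = mor F (?I U) (?I W) x"
    using oW U oI sub x
    by (intro unshift_unshift[OF F G \<phi> \<psi> ret st[OF oW] ne e] precosheaf_mor_in[OF pF]) auto
  finally show "mapper_shift \<U> e F \<psi> (thicken (e / 2) U) (mapper_shift \<U> e G \<phi> U x) =
      mor F (?I U) (?I (thicken (2 * (e / 2)) U)) x"
    by (simp add: T_def W_def)
qed

lemma interleaving_distance_mapper_le: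
  assumes F: "constructible_cosheaf F S" and G: "constructible_cosheaf G S"
    and \<U>: "nice_cover \<U>"
    and far: "\<And>s b. s \<in> S \<Longrightarrow> b \<in> boundary_points \<U> \<Longrightarrow> e < \<bar>s - b\<bar>"
    and e: "0 \<le> e" and il: "interleaving e F G \<phi> \<psi>"
  shows "interleaving_distance (mapper \<U> F) (mapper \<U> G) \<le> ennreal (e / 2)"
proof (rule interleaving_distance_le)
  show "interleaving (e / 2) (mapper \<U> F) (mapper \<U> G) (mapper_shift \<U> e G \<phi>) (mapper_shift \<U> e F \<psi>)"
    using il unfolding interleaving_iff
    by (intro conjI shift_map_mapper_shift[OF F G \<U> far e] shift_map_mapper_shift[OF G F \<U> far e]
        retracts_shift_mapper_shift[OF F G \<U> far e] retracts_shift_mapper_shift[OF G F \<U> far e]) auto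
qed (use e in simp)

text \<open>The infimum \<open>d\<close> need not be attained, so an interleaving with
  \<open>e\<close> slightly above \<open>d\<close> is halved. This gives strictness only for
  \<open>d > 0\<close>; at \<open>d = 0\<close> both distances vanish.\<close>

lemma interleaving_distance_mapper_less:
  assumes F: "constructible_cosheaf F S" and G: "constructible_cosheaf G S"
    and \<U>: "nice_cover \<U>"
    and less: "interleaving_distance F G < (INF s\<in>S. INF b\<in>boundary_points \<U>. ennreal \<bar>s - b\<bar>)"
  shows "interleaving_distance (mapper \<U> F) (mapper \<U> G) < interleaving_distance F G \<or>
    interleaving_distance (mapper \<U> F) (mapper \<U> G) = 0 \<and> interleaving_distance F G = 0"
proof -
  let ?d = "interleaving_distance F G" and ?D = "INF s\<in>S. INF b\<in>boundary_points \<U>. ennreal \<bar>s - b\<bar>"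
    and ?m = "interleaving_distance (mapper \<U> F) (mapper \<U> G)"
  have bound: "?m \<le> ennreal (e / 2)" if "0 \<le> e" "ennreal e < ?D" "interleaving e F G \<phi> \<psi>" for e \<phi> \<psi>
  proof (rule interleaving_distance_mapper_le[OF F G \<U> _ that(1,3)])
    fix s b assume s: "s \<in> S" and b: "b \<in> boundary_points \<U>"
    have "?D \<le> (INF b\<in>boundary_points \<U>. ennreal \<bar>s - b\<bar>)" by (rule INF_lower[OF s])
    also have "\<dots> \<le> ennreal \<bar>s - b\<bar>" by (rule INF_lower[OF b])
    finally have "?D \<le> ennreal \<bar>s - b\<bar>" .
    with that(2) have "ennreal e < ennreal \<bar>s - b\<bar>" by (rule less_le_trans)
    then show "e < \<bar>s - b\<bar>" using that(1) by (simp add: ennreal_less_iff)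
  qed
  \<comment> \<open>The strict hypothesis makes the distance finite, even when the infimum over an
    empty index set is \<open>top\<close>.\<close>
  have "?d < top" using less by (rule less_le_trans) simp
  then obtain d where d: "0 \<le> d" "?d = ennreal d"
    by (cases ?d) simp_all
  show ?thesis
  proof (cases "d = 0")
    case True
    have "?m \<le> ennreal c" if "0 < c" for c
    proof -
      have "?d < min ?D (ennreal c)" using less d True that by simp
      then obtain e \<phi> \<psi> where e: "0 \<le> e" "ennreal e < min ?D (ennreal c)" "interleaving e F G \<phi> \<psi>"
        by (rule interleaving_distance_lessE)
      then have "?m \<le> ennreal (e / 2)" by (intro bound) auto
      also have "\<dots> \<le> ennreal c" using e by (intro ennreal_leI) (auto simp: ennreal_less_iff)
      finally show ?thesis .
    qed
    then have "?m \<le> 0" using ennreal_le_epsilon[of 0 ?m] by simp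
    then show ?thesis using d True by simp
  next
    case False
    \<comment> \<open>The bound \<open>2 * d\<close> is what makes \<open>e / 2\<close> fall
      strictly below \<open>d\<close>.\<close>
    then have "?d < min ?D (ennreal (2 * d))"
      using less d by (simp add: ennreal_less_iff)
    then obtain e \<phi> \<psi> where e: "0 \<le> e" "ennreal e < min ?D (ennreal (2 * d))" "interleaving e F G \<phi> \<psi>"
      by (rule interleaving_distance_lessE)
    then have "?m \<le> ennreal (e / 2)" by (intro bound) auto
    also have "\<dots> < ennreal d" using e False d by (auto simp: ennreal_less_iff)
    finally show ?thesis using d by simp
  qed
qed

section \<open>Stability of Reeb cosheaves\<close>

lemma path_component_preimage_mono:
  assumes "\<And>x. x \<in> topspace X \<Longrightarrow> f x \<in> U \<Longrightarrow> g x \<in> V"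
    and "path_component_of (preimage_space X f U) x y"
  shows "path_component_of (preimage_space X g V) x y"
proof -
  have "{x \<in> topspace X. g x \<in> V} \<inter> {x \<in> topspace X. f x \<in> U} = {x \<in> topspace X. f x \<in> U}"
    using assms(1) by blast
  then have "subtopology (preimage_space X g V) {x \<in> topspace X. f x \<in> U} = preimage_space X f U"
    by (simp add: preimage_space_def subtopology_subtopology)
  then have "path_component_of (subtopology (preimage_space X g V) {x \<in> topspace X. f x \<in> U}) x y"
    using assms(2) by simp
  then show ?thesis
    by (auto simp: path_component_of_def pathin_subtopology)
qed

text \<open>With the target function \<open>g\<close> left free, one formula gives both the
  structure maps of a Reeb cosheaf and the interleaving maps between two of them.\<close>

definition component_map ::
  "'x topology \<Rightarrow> ('x \<Rightarrow> real) \<Rightarrow> real set \<Rightarrow> 'x set \<Rightarrow> 'x set" where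
  "component_map X g V C = (\<Union>x\<in>C. path_component_of_set (preimage_space X g V) x)"

lemma reeb_simps [simp]:
  "ob (reeb_cosheaf X f) U = path_components_of (preimage_space X f U)"
  "mor (reeb_cosheaf X f) U V = component_map X f V"
  by (simp_all add: reeb_cosheaf_def component_map_def fun_eq_iff)

lemma topspace_preimage_space [simp]: "topspace (preimage_space X f U) = {x \<in> topspace X. f x \<in> U}"
  by (auto simp: preimage_space_def)

text \<open>All points of the component are joined by paths in the larger preimage, so the union is
  taken over equal sets.\<close>

lemma component_map_eq:
  assumes "\<And>x. x \<in> topspace X \<Longrightarrow> f x \<in> U \<Longrightarrow> g x \<in> V" and "x \<in> topspace X" "f x \<in> U"
  shows "component_map X g V (path_component_of_set (preimage_space X f U) x) =
    path_component_of_set (preimage_space X g V) x"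
proof -
  let ?C = "path_component_of_set (preimage_space X f U) x"
  have "x \<in> ?C"
    using assms(2,3) by (simp add: path_component_of_refl)
  then have ne: "?C \<noteq> {}" by blast
  have eq: "path_component_of_set (preimage_space X g V) y = path_component_of_set (preimage_space X g V) x"
    if "y \<in> ?C" for y
  proof -
    have xy: "path_component_of (preimage_space X f U) x y" using that by (rule CollectD)
    have "path_component_of (preimage_space X g V) x y"
      by (rule path_component_preimage_mono[OF _ xy]) (rule assms(1))
    then have "path_component_of (preimage_space X g V) x = path_component_of (preimage_space X g V) y"
      by (rule path_component_of_equiv[THEN iffD1, THEN conjunct2, THEN conjunct2])
    then show ?thesis by (rule arg_cong[where f = Collect, symmetric])
  qed
  show ?thesis
    unfolding component_map_def by (rule SUP_eq_const; (rule ne | rule eq, assumption))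
qed

lemma path_components_preimageE:
  assumes "C \<in> path_components_of (preimage_space X f U)"
  obtains x where "x \<in> topspace X" "f x \<in> U" "C = path_component_of_set (preimage_space X f U) x"
  using assms by (auto simp: path_components_of_def)

lemma component_map_in:
  assumes "\<And>x. x \<in> topspace X \<Longrightarrow> f x \<in> U \<Longrightarrow> g x \<in> V" "C \<in> path_components_of (preimage_space X f U)"
  shows "component_map X g V C \<in> path_components_of (preimage_space X g V)"
  using assms(2)
proof (rule path_components_preimageE)
  fix x assume "x \<in> topspace X" "f x \<in> U" "C = path_component_of_set (preimage_space X f U) x"
  then show ?thesis
    using assms(1) component_map_eq[of X f U g V x] by (auto simp: path_components_of_def)
qed

lemma component_map_comp:
  assumes "\<And>x. x \<in> topspace X \<Longrightarrow> f x \<in> U \<Longrightarrow> g x \<in> V" "\<And>x. x \<in> topspace X \<Longrightarrow> g x \<in> V \<Longrightarrow> h x \<in> W"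
    and "C \<in> path_components_of (preimage_space X f U)"
  shows "component_map X h W (component_map X g V C) = component_map X h W C"
  using assms(3)
proof (rule path_components_preimageE)
  fix x assume x: "x \<in> topspace X" "f x \<in> U" "C = path_component_of_set (preimage_space X f U) x"
  have "component_map X g V C = path_component_of_set (preimage_space X g V) x"
    unfolding x(3) by (rule component_map_eq) (use assms(1) x in \<open>simp_all\<close>)
  moreover have "component_map X h W C = path_component_of_set (preimage_space X h W) x"
    unfolding x(3) by (rule component_map_eq) (use assms(1,2) x in \<open>simp_all\<close>)
  ultimately show ?thesis
    using component_map_eq[of X g V h W x] assms(1,2) x by simp
qed

text \<open>All maps are induced by inclusions of preimages, so the identities follow from
  \<open>component_map_comp\<close>. The non-strict bound \<open>e\<close> suffices because
  thickening reaches all points at distance at most \<open>e\<close>.\<close>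

lemma shift_map_reeb:
  assumes e: "0 \<le> e" and close: "\<And>x. x \<in> topspace X \<Longrightarrow> \<bar>f x - g x\<bar> \<le> e"
  shows "shift_map e (reeb_cosheaf X f) (reeb_cosheaf X g) (\<lambda>U. component_map X g (thicken e U))"
    and "retracts_shift e (reeb_cosheaf X f) (\<lambda>U. component_map X g (thicken e U))
      (\<lambda>U. component_map X f (thicken e U))"
proof -
  have fg: "g x \<in> thicken e U" if "open_interval U" "x \<in> topspace X" "f x \<in> U" for U x
    using close[OF that(2)] that
    by (auto simp: thicken_eq[OF that(1) e] abs_minus_commute[of "f x"] intro!: bexI[of _ "f x"])
  have gf: "f x \<in> thicken e U" if "open_interval U" "x \<in> topspace X" "g x \<in> U" for U x
    using close[OF that(2)] that by (auto simp: thicken_eq[OF that(1) e] intro!: bexI[of _ "g x"])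
  show "shift_map e (reeb_cosheaf X f) (reeb_cosheaf X g) (\<lambda>U. component_map X g (thicken e U))"
    unfolding shift_map_def reeb_simps
  proof (intro conjI allI impI)
    fix U C assume "open_interval U" and C: "C \<in> path_components_of (preimage_space X f U)"
    then show "component_map X g (thicken e U) C \<in> path_components_of (preimage_space X g (thicken e U))"
      by (intro component_map_in[OF fg])
  next
    fix U V C assume U: "open_interval U" and V: "open_interval V" and UV: "U \<subseteq> V"
      and C: "C \<in> path_components_of (preimage_space X f U)"
    have "component_map X g (thicken e V) (component_map X f V C) = component_map X g (thicken e V) C"
      by (rule component_map_comp[OF _ fg C]) (use UV V in auto)
    also have "\<dots> = component_map X g (thicken e V) (component_map X g (thicken e U) C)"
      by (rule component_map_comp[OF fg _ C, symmetric]) (use thicken_mono[OF U V UV e] U in auto)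
    finally show "component_map X g (thicken e V) (component_map X f V C) =
        component_map X g (thicken e V) (component_map X g (thicken e U) C)" .
  qed
  show "retracts_shift e (reeb_cosheaf X f) (\<lambda>U. component_map X g (thicken e U))
      (\<lambda>U. component_map X f (thicken e U))"
    unfolding retracts_shift_def reeb_simps
  proof (intro allI impI)
    fix U C assume U: "open_interval U" and C: "C \<in> path_components_of (preimage_space X f U)"
    have "thicken (2 * e) U = thicken e (thicken e U)" using thicken_thicken[OF U e e] by simp
    moreover have "component_map X f (thicken e (thicken e U)) (component_map X g (thicken e U) C) =
        component_map X f (thicken e (thicken e U)) C"
      by (rule component_map_comp[OF _ _ C]) (use fg gf U open_interval_thicken[OF U e] in auto)
    ultimately show "component_map X f (thicken e (thicken e U)) (component_map X g (thicken e U) C) =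
        component_map X f (thicken (2 * e) U) C"
      by simp
  qed
qed

lemma interleaving_distance_reeb_le:
  "interleaving_distance (reeb_cosheaf X f) (reeb_cosheaf X g) \<le> sup_dist X f g"
\<comment> \<open>A finite supremum is itself an admissible shift, with no limiting argument; an
  infinite one makes the bound trivial.\<close>
proof (cases "sup_dist X f g")
  case (real e)
  have close: "\<bar>f x - g x\<bar> \<le> e" if "x \<in> topspace X" for x
  proof -
    have "ennreal \<bar>f x - g x\<bar> \<le> ennreal e"
      unfolding real(2)[symmetric] sup_dist_def using that by (rule SUP_upper)
    then show ?thesis using real by simp
  qed
  have close': "\<bar>g x - f x\<bar> \<le> e" if "x \<in> topspace X" for x
    using close[OF that] by (simp add: abs_minus_commute)
  have "interleaving e (reeb_cosheaf X f) (reeb_cosheaf X g)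
      (\<lambda>U. component_map X g (thicken e U)) (\<lambda>U. component_map X f (thicken e U))"
    unfolding interleaving_iff using real close close' by (intro conjI shift_map_reeb) auto
  then show ?thesis using real interleaving_distance_le by metis
qed simp

section \<open>Invariance under isomorphism\<close>

text \<open>Conjugation of \<open>\<phi>\<close> by the isomorphisms; \<open>\<theta>\<close> is
  inverted on \<open>thicken e U\<close>, where \<open>\<phi>\<close> takes its values.\<close>

definition transport ::
  "real \<Rightarrow> 'b precosheaf_data \<Rightarrow> (real set \<Rightarrow> 'a \<Rightarrow> 'c) \<Rightarrow> (real set \<Rightarrow> 'b \<Rightarrow> 'd) \<Rightarrow>
   (real set \<Rightarrow> 'c \<Rightarrow> 'd) \<Rightarrow> real set \<Rightarrow> 'a \<Rightarrow> 'b" where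
  "transport e G \<eta> \<theta> \<phi> U x = inv_into (ob G (thicken e U)) (\<theta> (thicken e U)) (\<phi> U (\<eta> U x))"

definition natural_iso ::
  "'a precosheaf_data \<Rightarrow> 'b precosheaf_data \<Rightarrow> (real set \<Rightarrow> 'a \<Rightarrow> 'b) \<Rightarrow> bool" where
  "natural_iso F G \<eta> \<longleftrightarrow>
     (\<forall>U. open_interval U \<longrightarrow> bij_betw (\<eta> U) (ob F U) (ob G U)) \<and>
     (\<forall>U V x. open_interval U \<longrightarrow> open_interval V \<longrightarrow> U \<subseteq> V \<longrightarrow> x \<in> ob F U \<longrightarrow>
        \<eta> V (mor F U V x) = mor G U V (\<eta> U x))"

lemma precosheaf_iso_iff: "precosheaf_iso F G \<longleftrightarrow> (\<exists>\<eta>. natural_iso F G \<eta>)"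
  by (simp add: precosheaf_iso_def natural_iso_def Ball_def imp_conjL)

lemma natural_isoD:
  assumes "natural_iso F G \<eta>" "open_interval U"
  shows "x \<in> ob F U \<Longrightarrow> \<eta> U x \<in> ob G U"
    and "x \<in> ob F U \<Longrightarrow> y \<in> ob F U \<Longrightarrow> \<eta> U x = \<eta> U y \<Longrightarrow> x = y"
    and "open_interval V \<Longrightarrow> U \<subseteq> V \<Longrightarrow> x \<in> ob F U \<Longrightarrow> \<eta> V (mor F U V x) = mor G U V (\<eta> U x)"
  using assms unfolding natural_iso_def by (auto simp: bij_betw_def dest: inj_onD)

lemma transport:
  assumes \<eta>: "natural_iso F F' \<eta>" and \<theta>: "natural_iso G G' \<theta>" and \<phi>: "shift_map e F' G' \<phi>"
    and e: "0 \<le> e" and U: "open_interval U" and x: "x \<in> ob F U"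
  shows "transport e G \<eta> \<theta> \<phi> U x \<in> ob G (thicken e U)"
    and "\<theta> (thicken e U) (transport e G \<eta> \<theta> \<phi> U x) = \<phi> U (\<eta> U x)"
proof -
  have "\<phi> U (\<eta> U x) \<in> ob G' (thicken e U)"
    by (intro shift_mapD(1)[OF \<phi> U] natural_isoD(1)[OF \<eta> U] x)
  then have im: "\<phi> U (\<eta> U x) \<in> \<theta> (thicken e U) ` ob G (thicken e U)"
    using \<theta> open_interval_thicken[OF U e] by (auto simp: natural_iso_def bij_betw_def)
  show "transport e G \<eta> \<theta> \<phi> U x \<in> ob G (thicken e U)"
    unfolding transport_def using im by (rule inv_into_into)
  show "\<theta> (thicken e U) (transport e G \<eta> \<theta> \<phi> U x) = \<phi> U (\<eta> U x)"
    unfolding transport_def using im by (rule f_inv_into_f)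
qed

lemma shift_map_transport:
  assumes F: "precosheaf F" and G: "precosheaf G"
    and \<eta>: "natural_iso F F' \<eta>" and \<theta>: "natural_iso G G' \<theta>" and \<phi>: "shift_map e F' G' \<phi>"
    and e: "0 \<le> e"
  shows "shift_map e F G (transport e G \<eta> \<theta> \<phi>)"
  unfolding shift_map_def
proof (intro conjI allI impI)
  fix U x assume "open_interval U" "x \<in> ob F U"
  then show "transport e G \<eta> \<theta> \<phi> U x \<in> ob G (thicken e U)"
    by (rule transport(1)[OF \<eta> \<theta> \<phi> e])
next
  fix U V x assume U: "open_interval U" and V: "open_interval V" and UV: "U \<subseteq> V" and x: "x \<in> ob F U"
  note y = transport[OF \<eta> \<theta> \<phi> e U x]
  note Fx = precosheaf_mor_in[OF F U V UV x]
  note z = transport[OF \<eta> \<theta> \<phi> e V Fx]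
  note tU = open_interval_thicken[OF U e] and tV = open_interval_thicken[OF V e]
    and tUV = thicken_mono[OF U V UV e]
  show "transport e G \<eta> \<theta> \<phi> V (mor F U V x) = mor G (thicken e U) (thicken e V) (transport e G \<eta> \<theta> \<phi> U x)"
  \<comment> \<open>Injectivity of \<open>\<theta>\<close> reduces the square to the naturality of
    \<open>\<eta>\<close>, \<open>\<phi>\<close> and \<open>\<theta>\<close>.\<close>
  proof (rule natural_isoD(2)[OF \<theta> tV])
    show "transport e G \<eta> \<theta> \<phi> V (mor F U V x) \<in> ob G (thicken e V)" by (rule z(1))
    show "mor G (thicken e U) (thicken e V) (transport e G \<eta> \<theta> \<phi> U x) \<in> ob G (thicken e V)"
      by (rule precosheaf_mor_in[OF G tU tV tUV y(1)])
    show "\<theta> (thicken e V) (transport e G \<eta> \<theta> \<phi> V (mor F U V x)) =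
        \<theta> (thicken e V) (mor G (thicken e U) (thicken e V) (transport e G \<eta> \<theta> \<phi> U x))"
      by (simp add: z(2) y(2) natural_isoD(3)[OF \<theta> tU tV tUV y(1)] natural_isoD(3)[OF \<eta> U V UV x]
          shift_mapD(2)[OF \<phi> U V UV natural_isoD(1)[OF \<eta> U x]])
  qed
qed

lemma retracts_shift_transport:
  assumes F: "precosheaf F"
    and \<eta>: "natural_iso F F' \<eta>" and \<theta>: "natural_iso G G' \<theta>"
    and \<phi>: "shift_map e F' G' \<phi>" and \<psi>: "shift_map e G' F' \<psi>" and ret: "retracts_shift e F' \<phi> \<psi>"
    and e: "0 \<le> e"
  shows "retracts_shift e F (transport e G \<eta> \<theta> \<phi>) (transport e F \<theta> \<eta> \<psi>)"
  unfolding retracts_shift_def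
proof (intro allI impI)
  fix U x assume U: "open_interval U" and x: "x \<in> ob F U"
  have e2: "0 \<le> 2 * e" using e by simp
  note y = transport[OF \<eta> \<theta> \<phi> e U x]
  note tU = open_interval_thicken[OF U e] and t2U = open_interval_thicken[OF U e2]
  have TT: "thicken e (thicken e U) = thicken (2 * e) U" using thicken_thicken[OF U e e] by simp
  note z = transport[OF \<theta> \<eta> \<psi> e tU y(1), unfolded TT]
  show "transport e F \<theta> \<eta> \<psi> (thicken e U) (transport e G \<eta> \<theta> \<phi> U x) = mor F U (thicken (2 * e) U) x"
  proof (rule natural_isoD(2)[OF \<eta> t2U])
    show "mor F U (thicken (2 * e) U) x \<in> ob F (thicken (2 * e) U)"
      by (rule precosheaf_mor_in[OF F U t2U subset_thicken[OF U e2] x])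
  qed (simp_all add: z y(2) natural_isoD(3)[OF \<eta> U t2U subset_thicken[OF U e2] x]
      retracts_shiftD[OF ret U natural_isoD(1)[OF \<eta> U x]])
qed

text \<open>Every interleaving of \<open>F'\<close> and \<open>G'\<close> is conjugated to one of
  \<open>F\<close> and \<open>G\<close> with the same shift.\<close>

lemma interleaving_distance_iso_le:
  assumes F: "precosheaf F" and G: "precosheaf G" and "precosheaf_iso F F'" "precosheaf_iso G G'"
  shows "interleaving_distance F G \<le> interleaving_distance F' G'"
proof -
  obtain \<eta> \<theta> where \<eta>: "natural_iso F F' \<eta>" and \<theta>: "natural_iso G G' \<theta>"
    using assms by (auto simp: precosheaf_iso_iff)
  have "interleaving_distance F G \<le> ennreal e"
    if e: "0 \<le> e" and il: "interleaving e F' G' \<phi> \<psi>" for e \<phi> \<psi>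
  proof (rule interleaving_distance_le[OF e])
    show "interleaving e F G (transport e G \<eta> \<theta> \<phi>) (transport e F \<theta> \<eta> \<psi>)"
      using il unfolding interleaving_iff
      by (intro conjI shift_map_transport[OF F G \<eta> \<theta> _ e] shift_map_transport[OF G F \<theta> \<eta> _ e]
          retracts_shift_transport[OF F \<eta> \<theta> _ _ _ e] retracts_shift_transport[OF G \<theta> \<eta> _ _ _ e]) auto
  qed
  then show ?thesis
    unfolding interleaving_distance_def[of F' G'] by (intro Inf_greatest) auto
qed

text \<open>The second disjuncts cover distance zero, below which nothing can lie strictly.
  Isomorphism with the Reeb cosheaves replaces equality, since elements of \<open>F\<close> and
  \<open>G\<close> need not be sets of points of \<open>X\<close>.\<close>

theorem theorem4p4:
  fixes F :: "'a precosheaf_data" and G :: "'b precosheaf_data"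
    and S :: "real set" and \<U> :: "real set set"
  assumes "constructible_cosheaf F S"
    and "constructible_cosheaf G S"
    and "nice_cover \<U>"
    and "interleaving_distance F G < (INF s\<in>S. INF b\<in>boundary_points \<U>. ennreal \<bar>s - b\<bar>)"
  shows
    "(interleaving_distance (mapper \<U> F) (mapper \<U> G) < interleaving_distance F G \<or>
      interleaving_distance (mapper \<U> F) (mapper \<U> G) = 0 \<and> interleaving_distance F G = 0) \<and>
     (\<forall>(X :: 'x topology) (f :: 'x \<Rightarrow> real) (g :: 'x \<Rightarrow> real).
        constructible_R_space TYPE('v) X f \<and> constructible_R_space TYPE('w) X g \<and>
        precosheaf_iso F (reeb_cosheaf X f) \<and> precosheaf_iso G (reeb_cosheaf X g) \<longrightarrow>
        interleaving_distance (mapper \<U> F) (mapper \<U> G) < sup_dist X f g \<or>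
        interleaving_distance (mapper \<U> F) (mapper \<U> G) = 0 \<and> sup_dist X f g = 0)"
proof (intro conjI allI impI)
  note less = interleaving_distance_mapper_less[OF assms]
  then show "interleaving_distance (mapper \<U> F) (mapper \<U> G) < interleaving_distance F G \<or>
      interleaving_distance (mapper \<U> F) (mapper \<U> G) = 0 \<and> interleaving_distance F G = 0" .
  fix X :: "'x topology" and f g :: "'x \<Rightarrow> real"
  assume "constructible_R_space TYPE('v) X f \<and> constructible_R_space TYPE('w) X g \<and>
      precosheaf_iso F (reeb_cosheaf X f) \<and> precosheaf_iso G (reeb_cosheaf X g)"
  then have "interleaving_distance F G \<le> interleaving_distance (reeb_cosheaf X f) (reeb_cosheaf X g)"
    using assms(1,2) by (intro interleaving_distance_iso_le constructible_cosheaf_precosheaf) auto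
  also have "\<dots> \<le> sup_dist X f g" by (rule interleaving_distance_reeb_le)
  finally have "interleaving_distance F G \<le> sup_dist X f g" .
  then show "interleaving_distance (mapper \<U> F) (mapper \<U> G) < sup_dist X f g \<or>
      interleaving_distance (mapper \<U> F) (mapper \<U> G) = 0 \<and> sup_dist X f g = 0"
    \<comment> \<open>If the mapper distance and the distance of \<open>F\<close> and
      \<open>G\<close> both vanish, the sup distance is either zero as well or strictly
      larger.\<close>
    using less by (auto simp: zero_less_iff_neq_zero[symmetric] dest: less_le_trans)
qed

end
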